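(* Let $n\ge 3$ and let $V_{2n-1}$ and $V_{2n-3}$ be the modules of the Klein four group $G$ defined in the context, with $G$-equivariant surjection $\phi:V_{2n-1}\to V_{2n-3}$ and induced inclusion $\phi^*:F[V_{2n-3}]\hookrightarrow F[V_{2n-1}]$. Let $S\subseteq F[V_{2n-3}]^G$ be a separating set for $V_{2n-3}$. Then $\phi^{*}(S)$ together with the set $T$ consisting of \[x_{n+1},\quad N_G(x_1),\quad N_{H_2}(x_1x_{n+2}+x_{2}x_{n+1}),\quad \operatorname{Tr}^{G}(x_{1}x_{2}x_{n-1}),\] \[\operatorname{Tr}^G(x_1x_{i}x_{i+1})\ \text{ for } 2\le i\le n-2,\qquad \operatorname{Tr}^G(x_{1}x_{i}^{3})\ \text{ for } 2\le i\le n-1,\] is a separating set for $V_{2n-1}$.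
   Context: $F$ is an algebraically closed field of characteristic $2$ and $G=\{\iota,\sigma_1,\sigma_2,\sigma_3\}$ is the Klein four group with identity $\iota$ (so $\sigma_3=\sigma_1\sigma_2$); $H_2=\{\iota,\sigma_2\}$. For $n\ge 2$, $V_{2n-1}\cong F^{2n-1}$ with coordinates written $(a_1,\dots,a_{n-1},a_{n+1},\dots,a_{2n})$ (the index $n$ is omitted), on which $G$ acts by the block matrices $\sigma_{1}\mapsto\begin{pmatrix} I_{n-1}& (I_{n-1}\mid 0)\\ 0& I_{n}\end{pmatrix}$, $\sigma_{2}\mapsto\begin{pmatrix} I_{n-1}& (0\mid I_{n-1})\\ 0& I_{n}\end{pmatrix}$, where $(I_{n-1}\mid 0)$ and $(0\mid I_{n-1})$ are $(n-1)\times n$ matrices obtained by adjoining a zero column. $F[V]=S(V^* )$ has the action $\sigma(f)=f\circ\sigma^{-1}$, and $F[V]^G$ is the ring of invariants. With coordinate functions, $F[V_{2n-1}]=F[x_1,\dots,x_{n-1},x_{n+1},\dots,x_{2n}]$, where $\sigma_1(x_i)=x_i+x_{n+i}$ and $\sigma_2(x_i)=x_i+x_{n+i+1}$ for $1\le i\le n-1$, and $x_{n+1},\dots,x_{2n}$ are invariant. The module $V_{2n-3}$ is the one defined in the same way with $n-1$ in place of $n$. The surjection $\phi:V_{2n-1}\to V_{2n-3}$ is $(a_1,\dots,a_{n-1},a_{n+1},\dots,a_{2n})\mapsto(a_2,\dots,a_{n-1},a_{n+2},\dots,a_{2n})$, so that $\phi^*$, $f\mapsto f\circ\phi$, identifies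 $F[V_{2n-3}]$ with the subalgebra $F[x_2,\dots,x_{n-1},x_{n+2},\dots,x_{2n}]$ of $F[V_{2n-1}]$. For $f\in F[V]$, $\operatorname{Tr}^G(f)=\sum_{\sigma\in G}\sigma(f)$ and, for a subgroup $H\subseteq G$, $N_H(f)=\prod_{\sigma\in H}\sigma(f)$. A subset $A\subseteq F[V]^G$ is a separating set for $V$ if for all $u,w\in V$: $f(u)=f(w)$ for all $f\in A$ implies $f(u)=f(w)$ for all $f\in F[V]^G$. *)

theory Defs
  imports
    "HOL-Library.Poly_Mapping"
    "HOL-Computational_Algebra.Polynomial"
    "HOL-Algebra.Group"
begin

section \<open>Multivariate polynomials\<close>

text \<open>
  Polynomials in variables indexed by natural numbers: finitely supported maps from monomials
  (finitely supported exponent functions) to coefficients, with the convolution product.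
\<close>

type_synonym 'a mpoly = "(nat \<Rightarrow>\<^sub>0 nat) \<Rightarrow>\<^sub>0 'a"

definition Const :: "'a::comm_ring_1 \<Rightarrow> 'a mpoly" where
  "Const c = Poly_Mapping.single 0 c"

definition X :: "nat \<Rightarrow> 'a::comm_ring_1 mpoly" where
  "X i = Poly_Mapping.single (Poly_Mapping.single i 1) 1"

definition vars :: "'a::comm_ring_1 mpoly \<Rightarrow> nat set" where
  "vars p = (\<Union>m\<in>Poly_Mapping.keys p. Poly_Mapping.keys m)"

definition mp_hom :: "('a \<Rightarrow> 'b) \<Rightarrow> (nat \<Rightarrow> 'b) \<Rightarrow> 'a::comm_ring_1 mpoly \<Rightarrow> 'b::comm_ring_1" where
  "mp_hom c s p = (\<Sum>m\<in>Poly_Mapping.keys p. c (Poly_Mapping.lookup p m) *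
      (\<Prod>i\<in>Poly_Mapping.keys m. s i ^ Poly_Mapping.lookup m i))"

abbreviation eval :: "'a::comm_ring_1 mpoly \<Rightarrow> (nat \<Rightarrow> 'a) \<Rightarrow> 'a" where
  "eval p v \<equiv> mp_hom (\<lambda>c. c) v p"

abbreviation subst :: "(nat \<Rightarrow> 'a::comm_ring_1 mpoly) \<Rightarrow> 'a mpoly \<Rightarrow> 'a mpoly" where
  "subst s p \<equiv> mp_hom Const s p"


section \<open>The Klein four group\<close>

datatype klein4 = Iota | Sigma1 | Sigma2 | Sigma3

fun klein_mult :: "klein4 \<Rightarrow> klein4 \<Rightarrow> klein4" where
  "klein_mult Iota h = h"
| "klein_mult g Iota = g"
| "klein_mult Sigma1 Sigma1 = Iota"
| "klein_mult Sigma1 Sigma2 = Sigma3"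
| "klein_mult Sigma1 Sigma3 = Sigma2"
| "klein_mult Sigma2 Sigma1 = Sigma3"
| "klein_mult Sigma2 Sigma2 = Iota"
| "klein_mult Sigma2 Sigma3 = Sigma1"
| "klein_mult Sigma3 Sigma1 = Sigma2"
| "klein_mult Sigma3 Sigma2 = Sigma1"
| "klein_mult Sigma3 Sigma3 = Iota"

definition klein_four :: "klein4 monoid" where
  "klein_four = \<lparr>carrier = UNIV, mult = klein_mult, one = Iota\<rparr>"

definition H2 :: "klein4 set" where
  "H2 = {Iota, Sigma2}"


section \<open>The modules\<close>

text \<open>
  The parameter \<open>n\<close> below stands for the module of dimension \<open>2 * n - 1\<close>, for \<open>n \<ge> 2\<close>.
  Its vectors are functions on the natural numbers vanishing outside the index set, in which
  \<open>n\<close> itself is left out.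
\<close>

definition idx :: "nat \<Rightarrow> nat set" where
  "idx n = {1..n-1} \<union> {n+1..2*n}"

definition module_V :: "nat \<Rightarrow> (nat \<Rightarrow> 'a::comm_ring_1) set" where
  "module_V n = {a. \<forall>i. i \<notin> idx n \<longrightarrow> a i = 0}"

text \<open>
  Multiplication of coordinate vectors by the block matrices for \<open>\<sigma>\<^sub>1\<close> and \<open>\<sigma>\<^sub>2\<close>: row \<open>i < n\<close> of
  the upper right block has its single entry \<open>1\<close> in the column of \<open>a (n + i)\<close>, respectively
  of \<open>a (n + i + 1)\<close>.
\<close>

definition sigma1 :: "nat \<Rightarrow> (nat \<Rightarrow> 'a::comm_ring_1) \<Rightarrow> nat \<Rightarrow> 'a" where
  "sigma1 n a = (\<lambda>i. if i \<in> {1..n-1} then a i + a (n + i) else a i)"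

definition sigma2 :: "nat \<Rightarrow> (nat \<Rightarrow> 'a::comm_ring_1) \<Rightarrow> nat \<Rightarrow> 'a" where
  "sigma2 n a = (\<lambda>i. if i \<in> {1..n-1} then a i + a (n + i + 1) else a i)"

fun act :: "nat \<Rightarrow> klein4 \<Rightarrow> (nat \<Rightarrow> 'a::comm_ring_1) \<Rightarrow> nat \<Rightarrow> 'a" where
  "act n Iota = id"
| "act n Sigma1 = sigma1 n"
| "act n Sigma2 = sigma2 n"
| "act n Sigma3 = sigma1 n \<circ> sigma2 n"


section \<open>Coordinate rings, invariants and separating sets\<close>

definition coord_ring :: "nat \<Rightarrow> 'a::comm_ring_1 mpoly set" where
  "coord_ring n = {f. vars f \<subseteq> idx n}"

definition unit_vec :: "nat \<Rightarrow> nat \<Rightarrow> 'a::comm_ring_1" where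
  "unit_vec j = (\<lambda>i. if i = j then 1 else 0)"

text \<open>
  The formal counterpart of \<open>f \<mapsto> f \<circ> L\<close> for a linear map \<open>L\<close> defined on \<open>module_V n\<close>: each
  variable is replaced by the linear form whose coefficients are the entries of the matrix of
  \<open>L\<close>. See \<open>eval_pullback\<close> below.
\<close>

definition pullback :: "nat \<Rightarrow> ((nat \<Rightarrow> 'a) \<Rightarrow> nat \<Rightarrow> 'a) \<Rightarrow> 'a::comm_ring_1 mpoly \<Rightarrow> 'a mpoly" where
  "pullback n L = subst (\<lambda>i. \<Sum>j\<in>idx n. Const (L (unit_vec j) i) * X j)"

definition poly_act :: "nat \<Rightarrow> klein4 \<Rightarrow> 'a::comm_ring_1 mpoly \<Rightarrow> 'a mpoly" where
  "poly_act n g = pullback n (act n (inv\<^bsub>klein_four\<^esub> g))"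

definition invariants :: "nat \<Rightarrow> 'a::comm_ring_1 mpoly set" where
  "invariants n = {f \<in> coord_ring n. \<forall>g\<in>carrier klein_four. poly_act n g f = f}"

definition Tr :: "nat \<Rightarrow> 'a::comm_ring_1 mpoly \<Rightarrow> 'a mpoly" where
  "Tr n f = (\<Sum>g\<in>carrier klein_four. poly_act n g f)"

definition Norm :: "nat \<Rightarrow> klein4 set \<Rightarrow> 'a::comm_ring_1 mpoly \<Rightarrow> 'a mpoly" where
  "Norm n H f = (\<Prod>g\<in>H. poly_act n g f)"

definition separating_set :: "nat \<Rightarrow> 'a::comm_ring_1 mpoly set \<Rightarrow> bool" where
  "separating_set n A \<longleftrightarrow> A \<subseteq> invariants n \<and>
     (\<forall>u\<in>module_V n. \<forall>w\<in>module_V n.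
        (\<forall>f\<in>A. eval f u = eval f w) \<longrightarrow> (\<forall>f\<in>invariants n. eval f u = eval f w))"


section \<open>The surjection\<close>

text \<open>
  The surjection from \<open>module_V n\<close> onto \<open>module_V (n - 1)\<close>. The target has its own numbering of
  coordinates, \<open>1, \<dots>, n - 2\<close> and \<open>n, \<dots>, 2 * n - 2\<close>; these receive the coordinates
  \<open>2, \<dots>, n - 1\<close> and \<open>n + 2, \<dots>, 2 * n\<close>.
\<close>

definition phi :: "nat \<Rightarrow> (nat \<Rightarrow> 'a::comm_ring_1) \<Rightarrow> nat \<Rightarrow> 'a" where
  "phi n a = (\<lambda>i. if i \<in> {1..n-2} then a (i + 1)
                  else if i \<in> {n..2*n-2} then a (i + 2) else 0)"

definition phi_star :: "nat \<Rightarrow> 'a::comm_ring_1 mpoly \<Rightarrow> 'a mpoly" where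
  "phi_star n = pullback n (phi n)"


section \<open>Basic properties\<close>

lemma group_klein_four: "group klein_four"
proof (rule groupI)
  fix x y z
  show "x \<otimes>\<^bsub>klein_four\<^esub> y \<otimes>\<^bsub>klein_four\<^esub> z = x \<otimes>\<^bsub>klein_four\<^esub> (y \<otimes>\<^bsub>klein_four\<^esub> z)"
    by (cases x; cases y; cases z) (simp_all add: klein_four_def)
next
  fix x
  have "x \<otimes>\<^bsub>klein_four\<^esub> x = \<one>\<^bsub>klein_four\<^esub>"
    by (cases x) (simp_all add: klein_four_def)
  then show "\<exists>y\<in>carrier klein_four. y \<otimes>\<^bsub>klein_four\<^esub> x = \<one>\<^bsub>klein_four\<^esub>"
    by (intro bexI[of _ x]) (simp_all add: klein_four_def)
qed (simp_all add: klein_four_def)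

lemma inv_klein_four [simp]: "inv\<^bsub>klein_four\<^esub> g = g"
proof -
  interpret group klein_four by (rule group_klein_four)
  have "g \<otimes>\<^bsub>klein_four\<^esub> g = \<one>\<^bsub>klein_four\<^esub>"
    by (cases g) (simp_all add: klein_four_def)
  then show ?thesis
    by (intro inv_equality) (simp_all add: klein_four_def)
qed

lemma subgroup_H2: "subgroup H2 klein_four"
  by (rule group.subgroupI[OF group_klein_four]) (simp_all add: H2_def, auto simp: klein_four_def)

lemma carrier_klein_four: "carrier klein_four = {Iota, Sigma1, Sigma2, Sigma3}"
  using klein4.exhaust by (auto simp: klein_four_def)

lemma finite_idx [simp]: "finite (idx n)"
  by (simp add: idx_def)

lemma act_in_module_V: "a \<in> module_V n \<Longrightarrow> act n g a \<in> module_V n"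
  by (cases g) (auto simp: module_V_def sigma1_def sigma2_def idx_def)

lemma act_klein_mult:
  fixes a :: "nat \<Rightarrow> 'a::comm_ring_1"
  assumes "CHAR('a) = 2"
  shows "act n (g \<otimes>\<^bsub>klein_four\<^esub> h) a = act n g (act n h a)"
proof -
  have two: "x + x = 0" for x :: 'a
    using of_nat_CHAR[where ?'a = 'a] assms
    by (metis mult_2 mult_zero_left of_nat_numeral)
  have 1: "sigma1 n (sigma1 n b) = b" for b :: "nat \<Rightarrow> 'a"
    by (rule ext) (auto simp: sigma1_def add.assoc two)
  have 2: "sigma2 n (sigma2 n b) = b" for b :: "nat \<Rightarrow> 'a"
    by (rule ext) (auto simp: sigma2_def add.assoc two)
  have 3: "sigma2 n (sigma1 n b) = sigma1 n (sigma2 n b)" for b :: "nat \<Rightarrow> 'a"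
    by (rule ext) (auto simp: sigma1_def sigma2_def add_ac)
  show ?thesis
    by (cases g; cases h) (simp_all add: klein_four_def 1 2 3)
qed

lemma phi_in_module_V: "n \<ge> 2 \<Longrightarrow> phi n a \<in> module_V (n - 1)"
  by (auto simp: module_V_def phi_def idx_def)

lemma phi_surj:
  assumes "n \<ge> 3"
  shows "phi n ` module_V n = (module_V (n - 1) :: (nat \<Rightarrow> 'a::comm_ring_1) set)"
proof
  show "phi n ` module_V n \<subseteq> (module_V (n - 1) :: (nat \<Rightarrow> 'a) set)"
    using assms by (intro image_subsetI phi_in_module_V) simp
  show "(module_V (n - 1) :: (nat \<Rightarrow> 'a) set) \<subseteq> phi n ` module_V n"
  proof
    fix b :: "nat \<Rightarrow> 'a" assume b: "b \<in> module_V (n - 1)"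
    define a where "a = (\<lambda>i. if i \<in> {2..n-1} then b (i - 1)
                             else if i \<in> {n+2..2*n} then b (i - 2) else 0)"
    have "a \<in> module_V n"
      using assms by (auto simp: a_def module_V_def idx_def)
    moreover have "phi n a = b"
    proof
      fix i
      show "phi n a i = b i"
      proof (cases "i \<in> idx (n - 1)")
        case True
        then show ?thesis using assms by (auto simp: a_def phi_def idx_def)
      next
        case False
        then have "b i = 0" using b by (simp add: module_V_def)
        with False show ?thesis using assms by (auto simp: phi_def idx_def)
      qed
    qed
    ultimately show "b \<in> phi n ` module_V n" by blast
  qed
qed

lemma phi_equivariant:
  assumes "n \<ge> 3" shows "phi n (act n g a) = act (n - 1) g (phi n a)"
proof -
  obtain m where n: "n = Suc (Suc (Suc m))"
    using assms that[of "n - 3"] by simp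
  have 1: "phi n (sigma1 n a) = sigma1 (n - 1) (phi n a)" for a :: "nat \<Rightarrow> 'a"
    by (rule ext) (simp add: phi_def sigma1_def n)
  have 2: "phi n (sigma2 n a) = sigma2 (n - 1) (phi n a)" for a :: "nat \<Rightarrow> 'a"
    by (rule ext) (simp add: phi_def sigma2_def n)
  show ?thesis
    by (cases g) (simp_all add: 1 2)
qed

lemma mp_hom_superset:
  assumes "finite A" "Poly_Mapping.keys p \<subseteq> A" "c 0 = 0"
  shows "mp_hom c s p = (\<Sum>m\<in>A. c (Poly_Mapping.lookup p m) *
      (\<Prod>i\<in>Poly_Mapping.keys m. s i ^ Poly_Mapping.lookup m i))"
  unfolding mp_hom_def
  by (rule sum.mono_neutral_left) (use assms in \<open>auto simp: in_keys_iff\<close>)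

lemma mp_hom_add:
  assumes "c 0 = 0" "\<And>x y. c (x + y) = c x + c y"
  shows "mp_hom c s (p + q) = mp_hom c s p + mp_hom c s q"
proof -
  let ?A = "Poly_Mapping.keys p \<union> Poly_Mapping.keys q"
  have "Poly_Mapping.keys (p + q) \<subseteq> ?A" by (rule keys_add)
  then show ?thesis
    using mp_hom_superset[of ?A p c s] mp_hom_superset[of ?A q c s]
      mp_hom_superset[of ?A "p + q" c s] assms
    by (simp add: lookup_add distrib_right sum.distrib)
qed

lemma mp_hom_single:
  "c 0 = 0 \<Longrightarrow> mp_hom c s (Poly_Mapping.single m a) =
     c a * (\<Prod>i\<in>Poly_Mapping.keys m. s i ^ Poly_Mapping.lookup m i)"
  by (subst mp_hom_superset[of "{m}"]) auto

lemma monom_value_add: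
  fixes s :: "nat \<Rightarrow> 'b::comm_ring_1"
  shows "(\<Prod>i\<in>Poly_Mapping.keys (m + m'). s i ^ Poly_Mapping.lookup (m + m') i) =
    (\<Prod>i\<in>Poly_Mapping.keys m. s i ^ Poly_Mapping.lookup m i) *
    (\<Prod>i\<in>Poly_Mapping.keys m'. s i ^ Poly_Mapping.lookup m' i)"
proof -
  let ?A = "Poly_Mapping.keys m \<union> Poly_Mapping.keys m'"
  have *: "(\<Prod>i\<in>Poly_Mapping.keys k. s i ^ Poly_Mapping.lookup k i) =
      (\<Prod>i\<in>?A. s i ^ Poly_Mapping.lookup k i)"
    if "Poly_Mapping.keys k \<subseteq> ?A" for k
    by (rule prod.mono_neutral_left) (use that in \<open>auto simp: in_keys_iff\<close>)
  show ?thesis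
    using *[of m] *[of m'] *[OF keys_add]
    by (simp add: lookup_add power_add prod.distrib)
qed

lemma mp_hom_zero [simp]: "mp_hom c s 0 = 0"
  by (simp add: mp_hom_def)

lemma mp_hom_sum:
  assumes "c 0 = 0" "\<And>x y. c (x + y) = c x + c y"
  shows "mp_hom c s (\<Sum>x\<in>A. f x) = (\<Sum>x\<in>A. mp_hom c s (f x))"
  by (induction A rule: infinite_finite_induct) (simp_all add: mp_hom_add assms)

lemma mpoly_sum_single:
  "p = (\<Sum>m\<in>Poly_Mapping.keys p. Poly_Mapping.single m (Poly_Mapping.lookup p m))"
proof (rule poly_mapping_eqI)
  fix k
  show "Poly_Mapping.lookup p k = Poly_Mapping.lookup
      (\<Sum>m\<in>Poly_Mapping.keys p. Poly_Mapping.single m (Poly_Mapping.lookup p m)) k"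
    by (simp add: lookup_sum lookup_single when_def in_keys_iff)
qed

lemma mp_hom_mult:
  assumes "c 0 = 0" "\<And>x y. c (x + y) = c x + c y" "\<And>x y. c (x * y) = c x * c y"
  shows "mp_hom c s (p * q) = mp_hom c s p * mp_hom c s q"
proof -
  let ?s = "\<lambda>p m. Poly_Mapping.single m (Poly_Mapping.lookup p m)"
  have "p * q = (\<Sum>m\<in>Poly_Mapping.keys p. ?s p m) * (\<Sum>k\<in>Poly_Mapping.keys q. ?s q k)"
    by (simp only: mpoly_sum_single[symmetric])
  also have "\<dots> = (\<Sum>m\<in>Poly_Mapping.keys p. \<Sum>k\<in>Poly_Mapping.keys q. ?s p m * ?s q k)"
    by (rule sum_product)
  finally have "mp_hom c s (p * q) =
      (\<Sum>m\<in>Poly_Mapping.keys p. \<Sum>k\<in>Poly_Mapping.keys q. mp_hom c s (?s p m * ?s q k))"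
    by (simp add: mp_hom_sum[OF assms(1,2)])
  also have "\<dots> = (\<Sum>m\<in>Poly_Mapping.keys p. \<Sum>k\<in>Poly_Mapping.keys q.
      mp_hom c s (?s p m) * mp_hom c s (?s q k))"
    by (simp add: mult_single mp_hom_single assms(1,3) monom_value_add mult_ac)
  also have "\<dots> = mp_hom c s (\<Sum>m\<in>Poly_Mapping.keys p. ?s p m) *
      mp_hom c s (\<Sum>k\<in>Poly_Mapping.keys q. ?s q k)"
    by (simp add: mp_hom_sum[OF assms(1,2)] sum_product)
  finally show ?thesis
    by (simp add: mpoly_sum_single[symmetric])
qed

lemma Const_hom [simp]: "Const 0 = 0" "Const 1 = 1"
  by (simp_all add: Const_def)

lemma Const_add: "Const (x + y) = Const x + Const y"
  by (simp add: Const_def single_add)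

lemma Const_mult: "Const (x * y) = Const x * Const y"
  by (simp add: Const_def mult_single)

lemma mp_hom_X: "c 0 = 0 \<Longrightarrow> c 1 = 1 \<Longrightarrow> mp_hom c s (X i) = s i"
  by (simp add: X_def mp_hom_single)

lemma mp_hom_Const: "c 0 = 0 \<Longrightarrow> mp_hom c s (Const a) = c a"
  by (simp add: Const_def mp_hom_single)

lemma eval_simps [simp]:
  "eval (p + q) v = eval p v + eval q v"
  "eval (p * q) v = eval p v * eval q v"
  "eval (Const a) v = a"
  "eval (X i) v = v i"
  "eval 1 v = 1"
  by (simp_all add: mp_hom_add mp_hom_mult mp_hom_X mp_hom_Const mp_hom_Const[of "\<lambda>c. c" v 1, simplified])

lemma eval_sum: "eval (\<Sum>x\<in>A. f x) v = (\<Sum>x\<in>A. eval (f x) v)"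
  by (simp add: mp_hom_sum)

lemma eval_prod: "eval (\<Prod>x\<in>A. f x) v = (\<Prod>x\<in>A. eval (f x) v)"
  by (induction A rule: infinite_finite_induct) simp_all

lemma eval_power: "eval (p ^ k) v = eval p v ^ k"
  by (induction k) simp_all

lemma eval_subst: "eval (subst s p) v = eval p (\<lambda>i. eval (s i) v)"
  unfolding mp_hom_def[of Const] mp_hom_def[of _ "\<lambda>i. eval (s i) v"]
  by (simp add: eval_sum eval_prod eval_power)

definition lin :: "((nat \<Rightarrow> 'a::comm_ring_1) \<Rightarrow> nat \<Rightarrow> 'a) \<Rightarrow> bool" where
  "lin L \<longleftrightarrow> (\<forall>a b c d i. L (\<lambda>k. c * a k + d * b k) i = c * L a i + d * L b i)"

lemma lin_act: "lin (act n g)"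
  by (cases g) (auto simp: lin_def sigma1_def sigma2_def algebra_simps)

lemma lin_phi: "lin (phi n)"
  by (auto simp: lin_def phi_def)

lemma lin_sum:
  assumes "lin L" "finite J"
  shows "L (\<lambda>k. \<Sum>j\<in>J. v j * e j k) i = (\<Sum>j\<in>J. v j * L (e j) i)"
  using assms(2)
proof (induction J rule: finite_induct)
  case empty
  show ?case using assms(1)[unfolded lin_def, rule_format, of 0 "\<lambda>_. 0" 0 "\<lambda>_. 0" i] by simp
next
  case (insert j J)
  show ?case
    using insert assms(1)[unfolded lin_def, rule_format, of "v j" "e j" 1 "\<lambda>k. \<Sum>j\<in>J. v j * e j k" i]
    by simp
qed

lemma eval_pullback:
  assumes "lin L" "v \<in> module_V n"
  shows "eval (pullback n L f) v = eval f (L v)"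
proof -
  have v: "v = (\<lambda>k. \<Sum>j\<in>idx n. v j * unit_vec j k)"
  proof
    fix k
    have "(\<Sum>j\<in>idx n. v j * unit_vec j k) = (\<Sum>j\<in>idx n. if k = j then v j else 0)"
      by (intro sum.cong) (auto simp: unit_vec_def)
    also have "\<dots> = v k"
      using assms(2) by (auto simp: module_V_def)
    finally show "v k = (\<Sum>j\<in>idx n. v j * unit_vec j k)" by simp
  qed
  have "(\<lambda>i. eval (\<Sum>j\<in>idx n. Const (L (unit_vec j) i) * X j) v) = L v"
  proof
    fix i
    show "eval (\<Sum>j\<in>idx n. Const (L (unit_vec j) i) * X j) v = L v i"
      by (subst (2) v, subst lin_sum[OF assms(1)]) (simp_all add: eval_sum mult.commute)
  qed
  then show ?thesis
    by (simp add: pullback_def eval_subst)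
qed

lemma eval_poly_act:
  "v \<in> module_V n \<Longrightarrow> eval (poly_act n g f) v = eval f (act n (inv\<^bsub>klein_four\<^esub> g) v)"
  unfolding poly_act_def by (rule eval_pullback[OF lin_act])

lemma eval_phi_star: "v \<in> module_V n \<Longrightarrow> eval (phi_star n f) v = eval f (phi n v)"
  unfolding phi_star_def by (rule eval_pullback[OF lin_phi])

lemma sum_Const_X:
  fixes k n :: nat
  assumes "k \<in> idx n"
  shows "(\<Sum>j\<in>idx n. Const (if k = j then 1 else 0) * X j) = (X k :: 'a::comm_ring_1 mpoly)"
proof -
  have "(\<Sum>j\<in>idx n. Const (if k = j then 1 else 0) * X j) =
      (\<Sum>j\<in>idx n. if k = j then X j else 0 :: 'a mpoly)"
    by (intro sum.cong) auto
  then show ?thesis using assms by simp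
qed

lemma poly_act_X:
  fixes i n :: nat
  assumes "1 \<le> i" "i \<le> n - 1"
  shows "poly_act n Sigma1 (X i) = (X i + X (n + i) :: 'a::comm_ring_1 mpoly)"
    and "poly_act n Sigma2 (X i) = (X i + X (n + i + 1) :: 'a mpoly)"
proof -
  have *: "i \<in> idx n" "n + i \<in> idx n" "n + i + 1 \<in> idx n"
    using assms by (auto simp: idx_def)
  show "poly_act n Sigma1 (X i) = (X i + X (n + i) :: 'a mpoly)"
    using assms *[THEN sum_Const_X[where ?'a = 'a]]
    by (simp add: poly_act_def pullback_def mp_hom_X sigma1_def unit_vec_def
        Const_add distrib_right sum.distrib)
  show "poly_act n Sigma2 (X i) = (X i + X (n + i + 1) :: 'a mpoly)"
    using assms *[THEN sum_Const_X[where ?'a = 'a]]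
    by (simp add: poly_act_def pullback_def mp_hom_X sigma2_def unit_vec_def
        Const_add distrib_right sum.distrib)
qed

end

theory Submission
  imports Defs
begin

text \<open>
  A family of invariants separates exactly when two vectors on which it agrees always lie in one
  orbit, because the invariants of a finite group separate its orbits
  (\<open>invariants_separate_orbits\<close>). Let \<open>u\<close> and \<open>w\<close> be vectors on which the given family agrees. Since
  \<open>S\<close> separates orbits in the smaller module and the surjection is equivariant, \<open>w\<close> can be moved
  within its orbit until it has the same image there as \<open>u\<close>. As the coordinate \<open>x\<^sub>n\<^sub>+\<^sub>1\<close> is among the
  given functions, \<open>w\<close> then differs from \<open>u\<close> only in the first coordinate, by some scalar \<open>d\<close>.
  Write \<open>y\<^sub>i\<close> for the coordinate of \<open>u\<close> with index \<open>n + i\<close>, and suppose \<open>d \<noteq> 0\<close>.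

  The trace of \<open>x\<^sub>1 * f\<close> is affine in the first coordinate, with slope the trace of \<open>f\<close>, if \<open>f\<close> does
  not involve \<open>x\<^sub>1\<close> (\<open>eval_Tr_update_first\<close>). So equal values of the traces of \<open>x\<^sub>1 * f\<close> at \<open>u\<close> and \<open>w\<close>
  force the trace of \<open>f\<close> to vanish at \<open>u\<close>. For the products \<open>f\<close> that occur this says that
  \<open>y\<^sub>i * y\<^sub>i\<^sub>+\<^sub>1 * (y\<^sub>i + y\<^sub>i\<^sub>+\<^sub>1) = 0\<close>, that \<open>y\<^sub>i * y\<^sub>i\<^sub>+\<^sub>2 = y\<^sub>i\<^sub>+\<^sub>1 * y\<^sub>i\<^sub>+\<^sub>1\<close>, and that
  \<open>y\<^sub>2 * y\<^sub>n = y\<^sub>3 * y\<^sub>n\<^sub>-\<^sub>1\<close>. These equations leave three shapes for \<open>y\<^sub>2, \<dots>, y\<^sub>n\<close>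
  (\<open>degenerate_sequence_cases\<close>): all entries except perhaps the last vanish, only the first one is
  nonzero, or all are equal and nonzero. For a vector \<open>u\<close> of these shapes \<open>\<sigma>\<^sub>1\<close>, \<open>\<sigma>\<^sub>2\<close> and \<open>\<sigma>\<^sub>3\<close>,
  respectively, move no coordinate but the first. It remains that \<open>d\<close> is the
  displacement \<open>y\<^sub>1\<close>, \<open>y\<^sub>2\<close> or \<open>y\<^sub>1 + y\<^sub>2\<close> of that group element. In characteristic \<open>2\<close> the two norms
  are additive in the first coordinate up to a constant, so that equality of their values is a
  polynomial equation for \<open>d\<close> alone; the norm of \<open>x\<^sub>1\<close> settles the first shape, where \<open>y\<^sub>2 = 0\<close>, and the
  norm over \<open>H\<^sub>2\<close> the other two.
\<close>

section \<open>Substitution and pullback\<close>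

lemma subst_simps [simp]:
  "subst s (p + q) = subst s p + subst s q"
  "subst s (p * q) = subst s p * subst s q"
  "subst s (Const a) = Const a"
  "subst s (X i) = s i"
  "subst s (sum h A) = (\<Sum>x\<in>A. subst s (h x))"
  by (simp_all add: mp_hom_add mp_hom_mult mp_hom_X mp_hom_Const mp_hom_sum Const_add Const_mult)

lemma subst_one [simp]: "subst s 1 = 1"
  using subst_simps(3)[of s 1] by simp

lemma subst_prod [simp]: "subst s (prod h A) = (\<Prod>x\<in>A. subst s (h x))"
  by (induction A rule: infinite_finite_induct) simp_all

lemma subst_power [simp]: "subst s (p ^ k) = subst s p ^ k"
  by (induction k) simp_all

lemma subst_subst: "subst s (subst t p) = subst (\<lambda>i. subst s (t i)) p"
  unfolding mp_hom_def[of Const t] mp_hom_def[of Const "\<lambda>i. subst s (t i)"] by simp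

lemma module_V_expand:
  assumes "v \<in> module_V k"
  shows "v = (\<lambda>i. \<Sum>j\<in>idx k. v j * unit_vec j i)"
proof
  fix i
  have "(\<Sum>j\<in>idx k. v j * unit_vec j i) = (\<Sum>j\<in>idx k. if i = j then v j else 0)"
    by (intro sum.cong) (auto simp: unit_vec_def)
  also have "\<dots> = v i"
    using assms by (auto simp: module_V_def)
  finally show "v i = (\<Sum>j\<in>idx k. v j * unit_vec j i)" by simp
qed

lemma Const_sum: "Const (sum h A) = (\<Sum>x\<in>A. Const (h x))"
  by (induction A rule: infinite_finite_induct) (simp_all add: Const_add)

lemma unit_vec_in_module_V: "j \<in> idx n \<Longrightarrow> unit_vec j \<in> module_V n"
  by (auto simp: module_V_def unit_vec_def)

text \<open>
  Pulling back is contravariantly functorial on polynomials themselves, not only on the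
  functions they define. Composition of group elements and equivariance of the surjection
  enter the invariance proofs through it. The map applied first has to land in the module with
  coordinates \<open>idx k\<close> because \<open>pullback k\<close> reads off the matrix of \<open>L\<close> in these coordinates only.
\<close>

lemma pullback_pullback:
  assumes "lin L" and L': "\<And>v. v \<in> module_V m \<Longrightarrow> L' v \<in> module_V k"
  shows "pullback m L' (pullback k L f) = pullback m (L \<circ> L') f"
proof -
  have "(\<Sum>j\<in>idx k. Const (L (unit_vec j) i) * (\<Sum>l\<in>idx m. Const (L' (unit_vec l) j) * X l)) =
      (\<Sum>l\<in>idx m. Const (L (L' (unit_vec l)) i) * X l)" for i
  proof -
    have *: "L (L' (unit_vec l)) i = (\<Sum>j\<in>idx k. L' (unit_vec l) j * L (unit_vec j) i)"
      if "l \<in> idx m" for l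
      by (subst module_V_expand[OF L'[OF unit_vec_in_module_V[OF that]]])
        (rule lin_sum[OF assms(1) finite_idx])
    have "(\<Sum>j\<in>idx k. Const (L (unit_vec j) i) * (\<Sum>l\<in>idx m. Const (L' (unit_vec l) j) * X l)) =
        (\<Sum>l\<in>idx m. \<Sum>j\<in>idx k. Const (L (unit_vec j) i) * (Const (L' (unit_vec l) j) * X l))"
      by (simp add: sum_distrib_left) (rule sum.swap)
    also have "\<dots> = (\<Sum>l\<in>idx m. Const (L (L' (unit_vec l)) i) * X l)"
      by (intro sum.cong refl)
        (simp add: * Const_sum Const_mult sum_distrib_left mult_ac)
    finally show ?thesis .
  qed
  then show ?thesis
    by (simp add: pullback_def subst_subst)
qed

lemma coord_ring_add: "p \<in> coord_ring n \<Longrightarrow> q \<in> coord_ring n \<Longrightarrow> p + q \<in> coord_ring n"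
  using keys_add[of p q] unfolding coord_ring_def vars_def by blast

lemma coord_ring_mult:
  assumes "p \<in> coord_ring n" "q \<in> coord_ring n"
  shows "p * q \<in> coord_ring n"
  unfolding coord_ring_def vars_def
proof clarify
  fix m i assume m: "m \<in> Poly_Mapping.keys (p * q)" and i: "i \<in> Poly_Mapping.keys m"
  obtain a b where "m = a + b" "a \<in> Poly_Mapping.keys p" "b \<in> Poly_Mapping.keys q"
    using keys_mult[of p q] m by blast
  then show "i \<in> idx n"
    using i keys_add[of a b] assms unfolding coord_ring_def vars_def by blast
qed

lemma coord_ring_Const: "Const c \<in> coord_ring n"
  by (simp add: coord_ring_def vars_def Const_def)

lemma coord_ring_X: "i \<in> idx n \<Longrightarrow> X i \<in> coord_ring n"
  by (simp add: coord_ring_def vars_def X_def)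

lemma coord_ring_sum: "(\<And>x. x \<in> A \<Longrightarrow> h x \<in> coord_ring n) \<Longrightarrow> sum h A \<in> coord_ring n"
  using coord_ring_Const[of 0 n]
  by (induction A rule: infinite_finite_induct) (auto simp: coord_ring_add)

lemma coord_ring_prod: "(\<And>x. x \<in> A \<Longrightarrow> h x \<in> coord_ring n) \<Longrightarrow> prod h A \<in> coord_ring n"
  using coord_ring_Const[of 1 n]
  by (induction A rule: infinite_finite_induct) (auto simp: coord_ring_mult)

lemma coord_ring_power: "p \<in> coord_ring n \<Longrightarrow> p ^ k \<in> coord_ring n"
  using coord_ring_Const[of 1 n] by (induction k) (auto intro: coord_ring_mult)

lemmas coord_ring_closed = coord_ring_add coord_ring_mult coord_ring_Const coord_ring_X

lemma pullback_in_coord_ring: "pullback n L f \<in> coord_ring n"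
  unfolding pullback_def mp_hom_def[of Const]
  by (intro coord_ring_sum coord_ring_closed coord_ring_prod coord_ring_power)

section \<open>Invariants of the Klein four group\<close>

lemma two_eq_zero:
  assumes "CHAR('a::comm_ring_1) = 2"
  shows "(2::'a) = 0"
  using of_nat_CHAR[where ?'a = 'a] assms by simp

lemma add_eq_zero_iff_char_2:
  fixes a b :: "'a::comm_ring_1"
  assumes "CHAR('a) = 2"
  shows "a + b = 0 \<longleftrightarrow> a = b"
  using two_eq_zero[OF assms] by (metis add_right_imp_eq mult_2 mult_zero_left)

lemma act_coordinate:
  assumes "1 \<le> i" "i < n"
  shows "act n Sigma1 v i = v i + v (n + i)"
    and "act n Sigma2 v i = v i + v (n + i + 1)"
    and "act n Sigma3 v i = v i + v (n + i) + v (n + i + 1)"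
  using assms by (auto simp: sigma1_def sigma2_def add_ac)

lemma act_fixed_coordinate: "n < i \<Longrightarrow> act n g v i = v i"
  by (cases g) (auto simp: sigma1_def sigma2_def)

lemma poly_act_simps [simp]:
  "poly_act n g (p + q) = poly_act n g p + poly_act n g q"
  "poly_act n g (p * q) = poly_act n g p * poly_act n g q"
  "poly_act n g (sum h A) = (\<Sum>x\<in>A. poly_act n g (h x))"
  "poly_act n g (prod h A) = (\<Prod>x\<in>A. poly_act n g (h x))"
  by (simp_all add: poly_act_def pullback_def)

lemma poly_act_in_coord_ring: "poly_act n g f \<in> coord_ring n"
  by (simp add: poly_act_def pullback_in_coord_ring)

lemma poly_act_poly_act:
  fixes f :: "'a::comm_ring_1 mpoly"
  assumes "CHAR('a) = 2"
  shows "poly_act n h (poly_act n g f) = poly_act n (g \<otimes>\<^bsub>klein_four\<^esub> h) f"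
proof -
  have "act n (g \<otimes>\<^bsub>klein_four\<^esub> h) = (act n g \<circ> act n h :: (nat \<Rightarrow> 'a) \<Rightarrow> _)"
    by (rule ext) (simp add: act_klein_mult[OF assms])
  then show ?thesis
    by (simp add: poly_act_def pullback_pullback[OF lin_act act_in_module_V])
qed

lemma bij_betw_klein_mult_right:
  "bij_betw (\<lambda>g. g \<otimes>\<^bsub>klein_four\<^esub> h) (carrier klein_four) (carrier klein_four)"
proof -
  interpret group klein_four by (rule group_klein_four)
  have h: "h \<in> carrier klein_four"
    by (simp add: klein_four_def)
  then show ?thesis
    using inj_on_multc[OF h] surj_const_mult
    by (intro bij_betwI[where g = "\<lambda>g. g \<otimes>\<^bsub>klein_four\<^esub> inv\<^bsub>klein_four\<^esub> h"])
      (auto simp: m_assoc simp del: inv_klein_four)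
qed

lemma Norm_carrier_invariant:
  fixes f :: "'a::comm_ring_1 mpoly"
  assumes "CHAR('a) = 2"
  shows "Norm n (carrier klein_four) f \<in> invariants n"
  using prod.reindex_bij_betw[OF bij_betw_klein_mult_right, of "\<lambda>g. poly_act n g f"]
  by (simp add: invariants_def Norm_def coord_ring_prod poly_act_in_coord_ring
      poly_act_poly_act[OF assms])

lemma Tr_invariant:
  fixes f :: "'a::comm_ring_1 mpoly"
  assumes "CHAR('a) = 2"
  shows "Tr n f \<in> invariants n"
  using sum.reindex_bij_betw[OF bij_betw_klein_mult_right, of "\<lambda>g. poly_act n g f"]
  by (simp add: invariants_def Tr_def coord_ring_sum poly_act_in_coord_ring
      poly_act_poly_act[OF assms])

text \<open>
  A norm over the subgroup \<open>H2\<close> is only \<open>H2\<close>-invariant in general. If the polynomial is fixed by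
  \<open>\<sigma>\<^sub>1\<close>, it is invariant under the whole group, because \<open>\<sigma>\<^sub>1\<close> represents the other coset.
\<close>

lemma Norm_H2_invariant:
  fixes f :: "'a::comm_ring_1 mpoly"
  assumes "CHAR('a) = 2" and f: "poly_act n Sigma1 f = f"
  shows "Norm n H2 f \<in> invariants n"
proof -
  have "poly_act n Sigma3 f = poly_act n Sigma2 f"
    using poly_act_poly_act[OF assms(1), of n Sigma2 Sigma1 f] f by (simp add: klein_four_def)
  moreover have "poly_act n Iota f = f"
    using poly_act_poly_act[OF assms(1), of n Sigma1 Sigma1 f] f by (simp add: klein_four_def)
  ultimately have N: "Norm n H2 f = f * poly_act n Sigma2 f" and
    act: "poly_act n g f * poly_act n g (poly_act n Sigma2 f) = f * poly_act n Sigma2 f" for g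
    using f poly_act_poly_act[OF assms(1), of n g Sigma2 f]
    by (simp_all add: Norm_def H2_def) (cases g; simp add: klein_four_def mult.commute)
  have "Norm n H2 f \<in> coord_ring n"
    by (simp add: Norm_def coord_ring_prod poly_act_in_coord_ring)
  then show ?thesis
    using act by (simp add: invariants_def N)
qed

lemma poly_act_X_fixed:
  assumes "i \<in> {n+1..2*n}"
  shows "poly_act n g (X i) = (X i :: 'a::comm_ring_1 mpoly)"
proof -
  have "i \<in> idx n"
    using assms by (auto simp: idx_def)
  then show ?thesis
    using assms sum_Const_X[of i n, where ?'a = 'a]
    by (simp add: act_fixed_coordinate poly_act_def pullback_def unit_vec_def)
qed

lemma phi_star_invariant:
  assumes "n \<ge> 3" "f \<in> invariants (n - 1)"
  shows "phi_star n f \<in> invariants n"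
proof -
  have "poly_act n g (phi_star n f) = phi_star n f" for g
  proof -
    have "poly_act n g (phi_star n f) = pullback n (phi n \<circ> act n g) f"
      by (simp add: poly_act_def phi_star_def pullback_pullback[OF lin_phi act_in_module_V])
    also have "phi n \<circ> act n g = act (n - 1) g \<circ> phi n"
      by (rule ext) (simp only: comp_apply phi_equivariant[OF assms(1)])
    also have "pullback n (act (n - 1) g \<circ> phi n) f = phi_star n (poly_act (n - 1) g f)"
      unfolding poly_act_def phi_star_def inv_klein_four
      by (rule pullback_pullback[symmetric, OF lin_act phi_in_module_V]) (use assms(1) in simp)
    also have "poly_act (n - 1) g f = f"
      using assms(2) by (cases g) (auto simp: invariants_def carrier_klein_four)
    finally show ?thesis .
  qed
  then show ?thesis
    by (simp add: invariants_def phi_star_def pullback_in_coord_ring)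
qed

lemma eval_Norm:
  "v \<in> module_V n \<Longrightarrow> eval (Norm n H f) v = (\<Prod>g\<in>H. eval f (act n g v))"
  by (simp add: Norm_def eval_prod eval_poly_act)

lemma eval_Tr:
  "v \<in> module_V n \<Longrightarrow> eval (Tr n f) v = (\<Sum>g\<in>carrier klein_four. eval f (act n g v))"
  by (simp add: Tr_def eval_sum eval_poly_act)

lemma eval_invariant_act:
  assumes "f \<in> invariants n" "v \<in> module_V n"
  shows "eval f (act n g v) = eval f v"
proof -
  have "poly_act n g f = f"
    using assms(1) by (cases g) (auto simp: invariants_def carrier_klein_four)
  then show ?thesis
    using eval_poly_act[OF assms(2), of g f] by simp
qed

text \<open>
  If \<open>w\<close> is not in the orbit of \<open>u\<close>, a product of linear polynomials, one for each point of that
  orbit, vanishes on the orbit but has a value \<open>c \<noteq> 0\<close> at \<open>w\<close>. Subtracting it from \<open>c\<close> exchanges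
  the roles: the difference is \<open>c\<close> all along the orbit of \<open>u\<close> and \<open>0\<close> at \<open>w\<close>, so its norm is an
  invariant with the values \<open>c ^ 4\<close> at \<open>u\<close> and \<open>0\<close> at \<open>w\<close>.
\<close>

lemma invariants_separate_orbits:
  fixes u w :: "nat \<Rightarrow> 'a::field"
  assumes "CHAR('a) = 2"
    and u: "u \<in> module_V n" and w: "w \<in> module_V n"
    and eq: "\<And>f. f \<in> invariants n \<Longrightarrow> eval f u = eval f w"
  shows "\<exists>g. w = act n g u"
proof (rule ccontr)
  assume "\<not> ?thesis"
  then have "\<forall>g. \<exists>i. w i \<noteq> act n g u i" by (metis ext)
  then obtain i where i: "\<And>g. w (i g) \<noteq> act n g u (i g)" by metis
  define p where "p = (\<Prod>g\<in>carrier klein_four. X (i g) + Const (- act n g u (i g)))"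
  define c where "c = eval p w"
  define f where "f = Norm n (carrier klein_four) (Const c + Const (-1) * p)"
  have fin: "finite (carrier klein_four)"
    by (simp add: carrier_klein_four)
  have mem: "g \<in> carrier klein_four" for g
    by (simp add: klein_four_def)
  have c: "c \<noteq> 0"
    using i fin by (simp add: c_def p_def eval_prod)
  have "eval p (act n g u) = 0" for g
    using fin mem[of g] by (auto simp: p_def eval_prod)
  then have "eval f u \<noteq> 0"
    using c u fin by (simp add: f_def eval_Norm)
  moreover have "eval f w = 0"
    using w fin mem[of Iota]
    by (auto simp: f_def eval_Norm c_def intro!: bexI[of _ Iota])
  ultimately show False
    using eq[of f] Norm_carrier_invariant[OF assms(1)] by (simp add: f_def)
qed

section \<open>Vectors with the same image in the smaller module\<close>

lemma act_update_first:
  assumes "n \<ge> 2"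
  shows "act n g (u(1 := u 1 + d)) = (act n g u)(1 := act n g u 1 + d)"
  using assms by (cases g) (auto simp: sigma1_def sigma2_def fun_eq_iff)

text \<open>
  Every group element shifts the first coordinate by an amount that does not depend on that
  coordinate, so a change of the first coordinate by \<open>d\<close> persists along the whole orbit and leaves
  the factor \<open>f\<close> of each summand unchanged.
\<close>

lemma eval_Tr_update_first:
  assumes "n \<ge> 2" "u \<in> module_V n" "\<And>v c. eval f (v(1 := c)) = eval f v"
  shows "eval (Tr n (X 1 * f)) (u(1 := u 1 + d)) =
    eval (Tr n (X 1 * f)) u + d * eval (Tr n f) u"
proof -
  have "u(1 := u 1 + d) \<in> module_V n"
    using assms by (auto simp: module_V_def idx_def)
  then show ?thesis
    using assms
    by (simp add: eval_Tr act_update_first distrib_right sum.distrib sum_distrib_left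
        del: One_nat_def)
qed

text \<open>
  In the next two traces everything that involves \<open>u i\<close> or \<open>u j\<close> occurs an even number of times and
  cancels. The first is a \<open>2 \<times> 2\<close> determinant in the displacements of the two coordinates, the
  second the product of the displacements of one coordinate under \<open>\<sigma>\<^sub>1\<close>, \<open>\<sigma>\<^sub>2\<close> and \<open>\<sigma>\<^sub>3\<close>.
\<close>

lemma eval_Tr_mult:
  fixes u :: "nat \<Rightarrow> 'a::comm_ring_1"
  assumes "CHAR('a) = 2" "u \<in> module_V n" "1 \<le> i" "i < n" "1 \<le> j" "j < n"
  shows "eval (Tr n (X i * X j)) u =
    u (n + i) * u (n + j + 1) + u (n + i + 1) * u (n + j)"
proof -
  have "eval (Tr n (X i * X j)) u = u (n + i) * u (n + j + 1) + u (n + i + 1) * u (n + j) +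
      2 * (2 * u i * u j + u i * u (n + j) + u i * u (n + j + 1) + u (n + i) * u j
        + u (n + i + 1) * u j + u (n + i) * u (n + j) + u (n + i + 1) * u (n + j + 1))"
    using assms
    by (simp add: eval_Tr carrier_klein_four act_coordinate algebra_simps del: act.simps(2-))
  then show ?thesis
    by (simp add: two_eq_zero[OF assms(1)])
qed

lemma eval_Tr_cube:
  fixes u :: "nat \<Rightarrow> 'a::comm_ring_1"
  assumes "CHAR('a) = 2" "u \<in> module_V n" "1 \<le> i" "i < n"
  shows "eval (Tr n (X i ^ 3)) u =
    u (n + i) * u (n + i + 1) * (u (n + i) + u (n + i + 1))"
proof -
  define x p q where "x = u i" "p = u (n + i)" "q = u (n + i + 1)"
  have "eval (Tr n (X i ^ 3)) u = x ^ 3 + (x + p) ^ 3 + (x + q) ^ 3 + (x + p + q) ^ 3"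
    using assms
    by (simp add: x_p_q_def eval_Tr carrier_klein_four act_coordinate eval_power add_ac
        del: act.simps(2-))
  also have "\<dots> = p * q * (p + q) + 2 * (2 * x ^ 3 + 3 * x ^ 2 * (p + q)
      + 3 * x * (p ^ 2 + q ^ 2 + p * q) + p ^ 3 + q ^ 3 + p * q * (p + q))"
    by (simp add: power2_eq_square power3_eq_cube algebra_simps)
  finally show ?thesis
    by (simp add: two_eq_zero[OF assms(1)] x_p_q_def)
qed

text \<open>
  The norm of \<open>x\<^sub>1\<close> is the product of \<open>x\<^sub>1 + g\<close> over the four displacements
  \<open>g = 0, y\<^sub>1, y\<^sub>2, y\<^sub>1 + y\<^sub>2\<close>. In characteristic \<open>2\<close> its expansion has only terms of degree \<open>1\<close>, \<open>2\<close> and \<open>4\<close> in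
  \<open>x\<^sub>1\<close>, so it is additive.
\<close>

lemma eval_Norm_update_first:
  fixes u :: "nat \<Rightarrow> 'a::comm_ring_1"
  assumes "CHAR('a) = 2" "n \<ge> 2" "u \<in> module_V n"
  shows "eval (Norm n (carrier klein_four) (X 1)) (u(1 := u 1 + d)) =
    eval (Norm n (carrier klein_four) (X 1)) u +
    d * (d + u (n + 1)) * (d + u (n + 2)) * (d + u (n + 1) + u (n + 2))"
proof -
  define a p q where "a = u 1" "p = u (n + 1)" "q = u (n + 2)"
  have mem: "u(1 := u 1 + d) \<in> module_V n"
    using assms by (auto simp: module_V_def idx_def)
  define N where "N x = x * (x + p) * (x + q) * (x + p + q)" for x
  have 2: "2 * x = 0" for x :: 'a
    by (simp add: two_eq_zero[OF assms(1)])
  have N: "eval (Norm n (carrier klein_four) (X 1)) v = N (v 1)"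
    if "v \<in> module_V n" "v (n + 1) = p" "v (n + 2) = q" for v
    using that assms
    by (simp add: N_def eval_Norm carrier_klein_four act_coordinate mult_ac add_ac
        del: act.simps(2-))
  have "N x = x ^ 4 + x\<^sup>2 * (p\<^sup>2 + p * q + q\<^sup>2) + x * (p * q * (p + q))" for x
  proof -
    have "N x = x ^ 4 + x\<^sup>2 * (p\<^sup>2 + p * q + q\<^sup>2) + x * (p * q * (p + q))
        + 2 * (x ^ 3 * (p + q) + x\<^sup>2 * (p * q))"
      by (simp add: N_def power2_eq_square power3_eq_cube power4_eq_xxxx algebra_simps)
    then show ?thesis by (simp add: 2)
  qed
  moreover have "(a + d) ^ 4 = a ^ 4 + d ^ 4"
  proof -
    have "(a + d) ^ 4 = a ^ 4 + d ^ 4 + 2 * (2 * a ^ 3 * d + 3 * a\<^sup>2 * d\<^sup>2 + 2 * a * d ^ 3)"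
      by (simp add: power2_eq_square power3_eq_cube power4_eq_xxxx algebra_simps)
    then show ?thesis by (simp add: 2)
  qed
  moreover have "(a + d)\<^sup>2 = a\<^sup>2 + d\<^sup>2"
    by (simp add: power2_sum 2 mult.assoc)
  ultimately have "N (a + d) = N a + N d"
    by (simp add: algebra_simps)
  then show ?thesis
    using N[OF mem] N[OF assms(3)] assms(2) by (simp add: N_def a_p_q_def fun_upd_def)
qed

text \<open>
  With \<open>c = y\<^sub>2\<^sup>2 + y\<^sub>1 * y\<^sub>3\<close>, the displacement of \<open>f\<close> under \<open>\<sigma>\<^sub>2\<close>, the norm is \<open>f * (f + c)\<close>, which is
  additive in the value of \<open>f\<close>; and \<open>f\<close> is affine in the first coordinate with slope \<open>y\<^sub>2\<close>.
\<close>

lemma eval_Norm_H2_update_first: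
  fixes u :: "nat \<Rightarrow> 'a::comm_ring_1"
  assumes "CHAR('a) = 2" "n \<ge> 3" "u \<in> module_V n"
  defines "f \<equiv> X 1 * X (n + 2) + X 2 * X (n + 1)"
  shows "eval (Norm n H2 f) (u(1 := u 1 + d)) = eval (Norm n H2 f) u +
    d * u (n + 2) * (d * u (n + 2) + (u (n + 2))\<^sup>2 + u (n + 1) * u (n + 3))"
proof -
  have mem: "u(1 := u 1 + d) \<in> module_V n"
    using assms by (auto simp: module_V_def idx_def)
  define c where "c = (u (n + 2))\<^sup>2 + u (n + 1) * u (n + 3)"
  have N: "eval (Norm n H2 f) v = eval f v * (eval f v + c)"
    if "v \<in> module_V n" "v (n + 1) = u (n + 1)" "v (n + 2) = u (n + 2)" "v (n + 3) = u (n + 3)" for v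
    using that assms(2)
    by (simp add: f_def c_def eval_Norm H2_def act_coordinate act_fixed_coordinate algebra_simps
        power2_eq_square eval_nat_numeral del: act.simps(2-))
  have "eval f (u(1 := u 1 + d)) = eval f u + d * u (n + 2)"
    using assms(2) by (simp add: f_def algebra_simps)
  then have "eval (Norm n H2 f) (u(1 := u 1 + d)) =
      eval (Norm n H2 f) u + d * u (n + 2) * (d * u (n + 2) + c) + 2 * (eval f u * d * u (n + 2))"
    using N[OF mem] N[OF assms(3)] assms(2) by (simp add: algebra_simps)
  then show ?thesis
    by (simp add: two_eq_zero[OF assms(1)] c_def add.assoc)
qed

text \<open>
  By the quadratic relations a zero propagates to the right, as far as position \<open>n - 1\<close>: no
  relation with a square reaches \<open>y n\<close>. The last hypothesis closes this gap when \<open>y 2 \<noteq> 0\<close>. If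
  neither \<open>y 2\<close> nor \<open>y 3\<close> vanishes, the first cubic relation makes them equal, and the quadratic
  ones, which say that the sequence is geometric, make it constant.
\<close>

lemma degenerate_sequence_cases:
  fixes y :: "nat \<Rightarrow> 'a::field"
  assumes "CHAR('a) = 2" "n \<ge> 3"
    and cube: "\<And>i. 2 \<le> i \<Longrightarrow> i \<le> n - 1 \<Longrightarrow> y i * y (i + 1) * (y i + y (i + 1)) = 0"
    and quad: "\<And>i. 2 \<le> i \<Longrightarrow> i \<le> n - 2 \<Longrightarrow> y i * y (i + 2) + y (i + 1) * y (i + 1) = 0"
    and ends: "y 2 * y n + y 3 * y (n - 1) = 0"
  shows "(\<forall>i\<in>{2..n-1}. y i = 0) \<or>
    y 2 \<noteq> 0 \<and> (\<forall>i\<in>{3..n}. y i = 0) \<or>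
    y 2 \<noteq> 0 \<and> (\<forall>i\<in>{2..n}. y i = y 2)"
proof -
  note eq_iff = add_eq_zero_iff_char_2[OF assms(1)]
  have zero: "y i = 0" if "y k = 0" "2 \<le> k" "k \<le> i" "i \<le> n - 1" for i k
    using that(3,4)
  proof (induction i rule: dec_induct)
    case base
    show ?case by (rule that(1))
  next
    case (step i)
    then show ?case using quad[of i] that(2) by simp
  qed
  consider "y 2 = 0" | "y 2 \<noteq> 0" "y 3 = 0" | "y 2 \<noteq> 0" "y 3 \<noteq> 0" by blast
  then show ?thesis
  proof cases
    case 1
    then show ?thesis using zero[of 2] by simp
  next
    case 2
    have "y i = 0" if "i \<in> {3..n}" for i
    proof (cases "i = n")
      case True
      then show ?thesis using 2 ends by simp
    next
      case False
      then show ?thesis using that zero[of 3 i] 2 by auto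
    qed
    with 2 show ?thesis by blast
  next
    case 3
    have "y i = y 2 \<and> (i < n \<longrightarrow> y (i + 1) = y 2)" if "2 \<le> i" "i \<le> n" for i
      using that
    proof (induction i rule: dec_induct)
      case base
      show ?case using cube[of 2] 3 assms(2) by (simp add: eq_iff)
    next
      case (step i)
      then show ?case using quad[of i] 3(1) by (auto simp: eq_iff)
    qed
    then have "\<forall>i\<in>{2..n}. y i = y 2" by (meson atLeastAtMost_iff)
    with 3 show ?thesis by blast
  qed
qed

lemma phi_eqD:
  assumes "n \<ge> 3" "u \<in> module_V n" "w \<in> module_V n" "phi n u = phi n w" "i \<noteq> 1" "i \<noteq> n + 1"
  shows "u i = w i"
proof -
  consider "i \<in> {2..n-1}" | "i \<in> {n+2..2*n}" | "i \<notin> idx n"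
    using assms(5,6) by (force simp: idx_def)
  then show ?thesis
  proof cases
    case 1
    then show ?thesis using fun_cong[OF assms(4), of "i - 1"] by (auto simp: phi_def split: if_splits)
  next
    case 2
    then show ?thesis using fun_cong[OF assms(4), of "i - 2"] assms(1)
      by (auto simp: phi_def numeral_2_eq_2 Suc_diff_Suc split: if_splits)
  next
    case 3
    then show ?thesis using assms(2,3) by (simp add: module_V_def)
  qed
qed

text \<open>
  A fibre of \<open>phi n\<close> leaves only the coordinates \<open>1\<close> and \<open>n + 1\<close> free, and the second is prescribed.
  So it has to be shown that \<open>d = w 1 - u 1\<close> is the displacement of the first coordinate under a
  group element that fixes the other coordinates of \<open>u\<close>.
\<close>

lemma same_fibre_same_orbit:
  fixes u w :: "nat \<Rightarrow> 'a::field"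
  assumes char: "CHAR('a) = 2" and n: "n \<ge> 3"
    and u: "u \<in> module_V n" and w: "w \<in> module_V n" and phi: "phi n u = phi n w"
    and x: "u (n + 1) = w (n + 1)"
    and N: "eval (Norm n (carrier klein_four) (X 1)) u = eval (Norm n (carrier klein_four) (X 1)) w"
    and N2: "eval (Norm n H2 (X 1 * X (n + 2) + X 2 * X (n + 1))) u =
      eval (Norm n H2 (X 1 * X (n + 2) + X 2 * X (n + 1))) w"
    and T1: "eval (Tr n (X 1 * X 2 * X (n - 1))) u = eval (Tr n (X 1 * X 2 * X (n - 1))) w"
    and T2: "\<And>i. 2 \<le> i \<Longrightarrow> i \<le> n - 2 \<Longrightarrow>
      eval (Tr n (X 1 * X i * X (i + 1))) u = eval (Tr n (X 1 * X i * X (i + 1))) w"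
    and T3: "\<And>i. 2 \<le> i \<Longrightarrow> i \<le> n - 1 \<Longrightarrow>
      eval (Tr n (X 1 * X i ^ 3)) u = eval (Tr n (X 1 * X i ^ 3)) w"
  shows "\<exists>g. w = act n g u"
proof -
  define d where "d = w 1 - u 1"
  define y where "y i = u (n + i)" for i
  have w_eq: "w = u(1 := u 1 + d)"
  proof
    fix i
    show "w i = (u(1 := u 1 + d)) i"
      using phi_eqD[OF n u w phi, of i] x by (cases "i = n + 1") (auto simp: d_def)
  qed
  note eq_iff = add_eq_zero_iff_char_2[OF char]
  show ?thesis
  proof (cases "d = 0")
    case True
    then have "w = act n Iota u" using w_eq by simp
    then show ?thesis ..
  next
    case False
    \<comment> \<open>Dividing by \<open>d\<close>: a trace of \<open>x\<^sub>1 * f\<close> agreeing at \<open>u\<close> and \<open>w\<close> puts a condition on \<open>u\<close> alone.\<close>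
    have Tr0: "eval (Tr n f) u = 0"
      if "eval (Tr n (X 1 * f)) u = eval (Tr n (X 1 * f)) w"
        "\<And>v c. eval f (v(1 := c)) = eval f v" for f
      using eval_Tr_update_first[OF _ u that(2), of d] n that(1) False w_eq by simp
    have *: "y i * y (j + 1) + y (i + 1) * y j = 0"
      if "eval (Tr n (X 1 * (X i * X j))) u = eval (Tr n (X 1 * (X i * X j))) w"
        "2 \<le> i" "i < n" "2 \<le> j" "j < n" for i j
      using Tr0[of "X i * X j"] eval_Tr_mult[OF char u, of i j] that by (auto simp: y_def add.assoc)
    have ends: "y 2 * y n + y 3 * y (n - 1) = 0"
      using *[of 2 "n - 1"] T1 n by (simp add: mult.assoc)
    have quad: "y i * y (i + 2) + y (i + 1) * y (i + 1) = 0" if "2 \<le> i" "i \<le> n - 2" for i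
      using *[of i "i + 1"] T2[of i] that n by (simp add: mult.assoc)
    have cube: "y i * y (i + 1) * (y i + y (i + 1)) = 0" if "2 \<le> i" "i \<le> n - 1" for i
      using Tr0[of "X i ^ 3"] T3[of i] eval_Tr_cube[OF char u, of i] that
      by (auto simp: y_def add.assoc eval_power)
    have N2': "y 2 = 0 \<or> d * y 2 + (y 2)\<^sup>2 + y 1 * y 3 = 0"
      using N2 False eval_Norm_H2_update_first[OF char n u, of d] by (simp add: w_eq y_def)
    have "(\<forall>i\<in>{2..n-1}. y i = 0) \<or>
        y 2 \<noteq> 0 \<and> (\<forall>i\<in>{3..n}. y i = 0) \<or>
        y 2 \<noteq> 0 \<and> (\<forall>i\<in>{2..n}. y i = y 2)"
      using char n cube quad ends by (rule degenerate_sequence_cases)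
    then consider "\<forall>i\<in>{2..n-1}. y i = 0"
      | "y 2 \<noteq> 0" "\<forall>i\<in>{3..n}. y i = 0"
      | "y 2 \<noteq> 0" "\<forall>i\<in>{2..n}. y i = y 2"
      by blast
    then show ?thesis
    proof cases
      case 1
      \<comment> \<open>As \<open>y 2 = 0\<close>, the only nonzero root \<open>d\<close> is \<open>y 1\<close>.\<close>
      have "d * (d + y 1) * (d + y 2) * (d + y 1 + y 2) = 0"
        using N eval_Norm_update_first[OF char _ u, of d] n by (simp add: w_eq y_def)
      moreover have "y 2 = 0" using 1 n by simp
      ultimately have "d = y 1" using False by (simp add: eq_iff)
      then have "w = act n Sigma1 u"
        using 1 n by (auto simp: w_eq sigma1_def fun_eq_iff y_def)
      then show ?thesis ..
    next
      case 2
      \<comment> \<open>Here \<open>y 3 = 0\<close>, and a factor \<open>y 2\<close> cancels.\<close>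
      then have "d = y 2"
        using N2' n by (simp add: eq_iff power2_eq_square)
      moreover have "u (Suc (n + i)) = 0" if "2 \<le> i" "i \<le> n - 1" for i
        using bspec[OF 2(2), of "i + 1"] that by (simp add: y_def)
      ultimately have "w = act n Sigma2 u"
        using n by (auto simp: w_eq sigma2_def fun_eq_iff y_def)
      then show ?thesis ..
    next
      case 3
      have "d * y 2 + (y 2)\<^sup>2 + y 1 * y 3 = (d + (y 2 + y 1)) * y 2"
        using bspec[OF 3(2), of 3] n by (simp add: power2_eq_square algebra_simps)
      then have "d = y 2 + y 1"
        using N2' 3(1) by (simp add: eq_iff)
      moreover have "u (Suc (n + i)) + u (n + i) = 0" if "2 \<le> i" "i \<le> n - 1" for i
        using bspec[OF 3(2), of i] bspec[OF 3(2), of "i + 1"] that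
        unfolding eq_iff by (simp add: y_def)
      ultimately have "w = act n Sigma3 u"
        using n by (auto simp: w_eq sigma1_def sigma2_def fun_eq_iff y_def add.assoc)
      then show ?thesis ..
    qed
  qed
qed

section \<open>The separating set\<close>

theorem proposition8:
  fixes n :: nat and S :: "'a::alg_closed_field mpoly set"
  assumes "CHAR('a) = 2"
    and "n \<ge> 3"
    and "separating_set (n - 1) S"
  shows "separating_set n
    (phi_star n ` S \<union>
     ({X (n + 1),
       Norm n (carrier klein_four) (X 1),
       Norm n H2 (X 1 * X (n + 2) + X 2 * X (n + 1)),
       Tr n (X 1 * X 2 * X (n - 1))}
      \<union> {Tr n (X 1 * X i * X (i + 1)) | i. 2 \<le> i \<and> i \<le> n - 2}
      \<union> {Tr n (X 1 * X i ^ 3) | i. 2 \<le> i \<and> i \<le> n - 1}))"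
    (is "separating_set n (_ \<union> ?T)")
proof -
  have X: "X (n + 1) \<in> (invariants n :: 'a mpoly set)"
    using assms(2)
    by (auto simp: invariants_def poly_act_X_fixed idx_def intro!: coord_ring_closed)
  have two: "p + p = 0" for p :: "'a mpoly"
  proof -
    have "p + p = Const 2 * p"
      using Const_add[of 1 "1::'a"] by (simp add: distrib_right)
    then show ?thesis by (simp add: two_eq_zero[OF assms(1)])
  qed
  have "poly_act n Sigma1 (X 1 * X (n + 2) + X 2 * X (n + 1)) =
      (X 1 * X (n + 2) + X 2 * X (n + 1)) +
      (X (n + 1) * X (n + 2) + X (n + 1) * X (n + 2) :: 'a mpoly)"
    using assms(2) poly_act_X(1)[of 1 n, where ?'a = 'a] poly_act_X(1)[of 2 n, where ?'a = 'a]
    by (simp add: poly_act_X_fixed algebra_simps)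
  then have H2: "Norm n H2 (X 1 * X (n + 2) + X 2 * X (n + 1)) \<in> (invariants n :: 'a mpoly set)"
    by (intro Norm_H2_invariant assms(1)) (simp add: two)
  have T: "?T \<subseteq> invariants n"
    using X H2 Norm_carrier_invariant[OF assms(1)] Tr_invariant[OF assms(1)] by blast
  have S: "phi_star n ` S \<subseteq> invariants n"
    using assms(2,3) phi_star_invariant by (auto simp: separating_set_def)
  have sep: "eval f u = eval f w"
    if u: "u \<in> module_V n" and w: "w \<in> module_V n" and f: "f \<in> invariants n"
      and eq: "\<forall>f\<in>phi_star n ` S \<union> ?T. eval f u = eval f w" for u w f
  proof -
    have phi: "phi n u \<in> module_V (n - 1)" "phi n w \<in> module_V (n - 1)"
      using assms(2) by (intro phi_in_module_V, simp)+
    have eqS: "eval f (phi n w) = eval f (phi n u)" if "f \<in> S" for f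
    proof -
      have "eval (phi_star n f) u = eval (phi_star n f) w"
        using that by (intro bspec[OF eq]) (rule UnI1, rule imageI)
      then show ?thesis
        using u w by (simp add: eval_phi_star)
    qed
    have "eval f (phi n w) = eval f (phi n u)" if "f \<in> invariants (n - 1)" for f
      using assms(3) phi eqS that unfolding separating_set_def by blast
    then have "\<exists>g. phi n u = act (n - 1) g (phi n w)"
      by (intro invariants_separate_orbits assms(1) phi)
    then obtain g where "phi n u = act (n - 1) g (phi n w)" ..
    \<comment> \<open>Equivariance lifts the group element: \<open>act n g w\<close> replaces \<open>w\<close>.\<close>
    then have g: "phi n u = phi n (act n g w)"
      unfolding phi_equivariant[OF assms(2)] .
    have w': "act n g w \<in> module_V n"
      using w by (rule act_in_module_V)
    have eq': "eval f u = eval f (act n g w)" if "f \<in> ?T" for f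
    proof -
      have "eval f u = eval f w"
        using that by (intro bspec[OF eq]) (rule UnI2)
      also have "\<dots> = eval f (act n g w)"
        using T that by (intro eval_invariant_act[symmetric] w) (rule subsetD)
      finally show ?thesis .
    qed
    have "\<exists>h. act n g w = act n h u"
    proof (rule same_fibre_same_orbit[OF assms(1,2) u w' g])
      have "eval (X (n + 1)) u = eval (X (n + 1)) (act n g w)"
        by (rule eq') (simp only: Un_iff insert_iff simp_thms)
      then show "u (n + 1) = act n g w (n + 1)"
        by simp
    next
      fix i assume i: "2 \<le> i" "i \<le> n - 2"
      then have "Tr n (X 1 * X i * X (i + 1)) \<in>
          {Tr n (X 1 * X i * X (i + 1)) | i. 2 \<le> i \<and> i \<le> n - 2}" by blast
      then show "eval (Tr n (X 1 * X i * X (i + 1))) u =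
          eval (Tr n (X 1 * X i * X (i + 1))) (act n g w)"
        by (intro eq' UnI1[OF UnI2])
    next
      fix i assume i: "2 \<le> i" "i \<le> n - 1"
      then have "Tr n (X 1 * X i ^ 3) \<in> {Tr n (X 1 * X i ^ 3) | i. 2 \<le> i \<and> i \<le> n - 1}" by blast
      then show "eval (Tr n (X 1 * X i ^ 3)) u = eval (Tr n (X 1 * X i ^ 3)) (act n g w)"
        by (intro eq' UnI2)
    qed (rule eq', simp only: Un_iff insert_iff simp_thms)+
    then obtain h where h: "act n g w = act n h u" ..
    show ?thesis
      using eval_invariant_act[OF f u, of h] eval_invariant_act[OF f w, of g] h by simp
  qed
  show ?thesis
    unfolding separating_set_def
    by (intro conjI Un_least[OF S T] ballI impI) (rule sep)
qed

end
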